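(* Let $n$ be a positive integer, let $a,b$ be non-negative integers and let $c\ge 1$ be an integer. Then $$S_n(\{1\}^a,c,\{1\}^b)=\sum_{k=1}^n \frac{(-1)^{k-1}\binom{n}{k}}{k^{a+b+c}}+\sum_{\substack{i\ge 1,\ j\ge 1,\ |\mathbf{s}|\ge 0\\ i+j+|\mathbf{s}|=c}}\ \sum_{k=1}^n\frac{H_{k-1}(a+i,\mathbf{s})\,(-1)^{k-1}\binom{n}{k}}{k^{b+j}},$$ where the outer sum in the second term runs over all integers $i\ge 1$, $j\ge 1$ and all finite (possibly empty) sequences $\mathbf{s}=(s_1,\dots,s_r)$ of positive integers, $r\ge0$, with $i+j+|\mathbf{s}|=c$.
   Context: For a sequence $\mathbf{s}=(s_1,\dots,s_r)$ of positive integers and an integer $n\ge 0$: $H_n(\mathbf{s})=\sum_{1\le k_1<k_2<\cdots<k_r\le n}\frac{1}{k_1^{s_1}\cdots k_r^{s_r}}$ and $S_n(\mathbf{s})=\sum_{1\le k_1\le\cdots\le k_r\le n}\frac{1}{k_1^{s_1}\cdots k_r^{s_r}}$. Conventions: $H_n(\mathbf{s})=0$ if $n<r$, and $H_n(\emptyset)=S_n(\emptyset)=1$. The weight is $|\mathbf{s}|=s_1+\cdots+s_r$ ($0$ for the empty sequence). $\{1\}^a$ denotes $1$ repeated $a$ times; $H_{k-1}(a+i,\mathbf{s})$ means $H_{k-1}(a+i,s_1,\dots,s_r)$. *)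

theory Defs
  imports Complex_Main
begin

text \<open>An exponent sequence is a list of naturals; the positivity of its entries is stated where
  it matters. The strictly (weakly) increasing index tuples are also lists.\<close>

definition strict_tuples :: "nat \<Rightarrow> nat \<Rightarrow> nat list set" where
  "strict_tuples n r = {ks. length ks = r \<and> sorted_wrt (<) ks \<and> set ks \<subseteq> {1..n}}"

definition weak_tuples :: "nat \<Rightarrow> nat \<Rightarrow> nat list set" where
  "weak_tuples n r = {ks. length ks = r \<and> sorted_wrt (\<le>) ks \<and> set ks \<subseteq> {1..n}}"

definition mhs_H :: "nat \<Rightarrow> nat list \<Rightarrow> real" where
  "mhs_H n s = (\<Sum>ks\<in>strict_tuples n (length s). 1 / (\<Prod>l<length s. real (ks ! l) ^ (s ! l)))"

definition mhs_S :: "nat \<Rightarrow> nat list \<Rightarrow> real" where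
  "mhs_S n s = (\<Sum>ks\<in>weak_tuples n (length s). 1 / (\<Prod>l<length s. real (ks ! l) ^ (s ! l)))"

definition splittings :: "nat \<Rightarrow> (nat \<times> nat \<times> nat list) set" where
  "splittings c = {(i, j, s). i \<ge> 1 \<and> j \<ge> 1 \<and> (\<forall>x\<in>set s. x \<ge> 1) \<and> i + j + sum_list s = c}"

text \<open>All these index sets are finite, so none of the sums is \<open>0\<close> by default, and the usual
  conventions for \<open>H\<close> and \<open>S\<close> are consequences of the definitions.\<close>

lemma finite_strict_tuples: "finite (strict_tuples n r)"
  by (rule finite_subset[OF _ finite_lists_length_eq[of "{1..n}" r]])
     (auto simp: strict_tuples_def)

lemma finite_weak_tuples: "finite (weak_tuples n r)"
  by (rule finite_subset[OF _ finite_lists_length_eq[of "{1..n}" r]])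
     (auto simp: weak_tuples_def)

lemma length_le_sum_list:
  fixes s :: "nat list"
  assumes "\<forall>x\<in>set s. x \<ge> 1"
  shows "length s \<le> sum_list s"
  using assms by (induction s) auto

lemma finite_splittings: "finite (splittings c)"
proof (rule finite_subset)
  show "splittings c \<subseteq> {..c} \<times> {..c} \<times> {s. set s \<subseteq> {..c} \<and> length s \<le> c}"
  proof
    fix t assume "t \<in> splittings c"
    then obtain i j s where t: "t = (i, j, s)" and s: "\<forall>x\<in>set s. x \<ge> 1"
      and sum: "i + j + sum_list s = c"
      by (auto simp: splittings_def)
    have "x \<le> c" if "x \<in> set s" for x
      using member_le_sum_list[OF that] sum by linarith
    moreover have "length s \<le> c"
      using length_le_sum_list[OF s] sum by linarith
    ultimately show "t \<in> {..c} \<times> {..c} \<times> {s. set s \<subseteq> {..c} \<and> length s \<le> c}"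
      using t sum by auto
  qed
  show "finite ({..c} \<times> {..c} \<times> {s. set s \<subseteq> {..c} \<and> length s \<le> c})"
    by (intro finite_cartesian_product finite_lists_length_le) auto
qed

lemma mhs_H_Nil: "mhs_H n [] = 1"
proof -
  have "strict_tuples n 0 = {[]}" by (auto simp: strict_tuples_def)
  then show ?thesis by (simp add: mhs_H_def)
qed

lemma mhs_S_Nil: "mhs_S n [] = 1"
proof -
  have "weak_tuples n 0 = {[]}" by (auto simp: weak_tuples_def)
  then show ?thesis by (simp add: mhs_S_def)
qed

lemma mhs_H_eq_0:
  assumes "n < length s"
  shows "mhs_H n s = 0"
proof -
  have "strict_tuples n (length s) = {}"
  proof (rule equals0I)
    fix ks assume "ks \<in> strict_tuples n (length s)"
    then have len: "length ks = length s" and "distinct ks" and sub: "set ks \<subseteq> {1..n}"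
      by (auto simp: strict_tuples_def strict_sorted_iff)
    then have "length s = card (set ks)" by (simp add: distinct_card)
    also have "\<dots> \<le> n" using card_mono[OF _ sub] by simp
    finally show False using assms by simp
  qed
  then show ?thesis by (simp add: mhs_H_def)
qed

end

theory Submission
  imports Defs
begin

text \<open>
  Two operations on sequences \<open>g 1, g 2, \<dots>\<close> build weak sums: \<open>D\<close>, division of the \<open>k\<close>-th term
  by \<open>k\<close>, and \<open>P\<close>, the passage to partial sums. Peeling off the largest summation index gives
  \<open>S\<^sub>n({1}\<^sup>a, c, {1}\<^sup>b) = (P D)\<^sup>b P D\<^sup>c (P D)\<^sup>a 1\<close>, evaluated at \<open>n\<close>.

  The alternating binomial transform \<open>T\<close> exchanges \<open>D\<close> and \<open>P D\<close>: it satisfies \<open>P D T = T D\<close>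
  (\<open>sum_binomial_transform\<close>) and \<open>D T = T P D\<close> (\<open>binomial_transform_divide\<close>), and it fixes the
  constant \<open>1\<close>. Writing \<open>1 = T 1\<close> and moving \<open>T\<close> to the front turns the sum above into
  \<open>T D\<^sup>b\<^sup>+\<^sup>1 (P D)\<^sup>c\<^sup>-\<^sup>1 D\<^sup>a 1\<close>, which is already an alternating binomial sum with \<open>k\<^sup>b\<^sup>+\<^sup>1\<close> in the
  denominator (\<open>mhs_S_hook\<close>).

  The remaining factor \<open>(P D)\<^sup>c\<^sup>-\<^sup>1 D\<^sup>a 1\<close> is again a sum over weakly increasing indices, all at
  most \<open>k\<close>. Grouping equal indices rewrites it through strict sums: the bound \<open>k\<close> itself is
  attained \<open>j - 1\<close> times, and the smaller indices, with their multiplicities as exponents, form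
  \<open>H\<^sub>k\<^sub>-\<^sub>1(a + i, s)\<close>; the outer \<open>D\<^sup>b\<^sup>+\<^sup>1\<close> then completes the denominator \<open>k\<^sup>b\<^sup>+\<^sup>j\<close>
  (\<open>iterated_harmonic_eq_mhs_H\<close>). The tuples with all indices equal to \<open>k\<close> give the first sum.
\<close>

section \<open>Peeling off the largest index\<close>

lemma strict_tuples_Suc:
  "strict_tuples n (Suc r) = (\<lambda>(m, ks). ks @ [m]) ` (SIGMA m:{1..n}. strict_tuples (m - 1) r)"
proof (intro equalityI subsetI)
  fix xs assume xs: "xs \<in> strict_tuples n (Suc r)"
  then obtain ks m where "xs = ks @ [m]"
    by (cases xs rule: rev_cases) (auto simp: strict_tuples_def)
  with xs show "xs \<in> (\<lambda>(m, ks). ks @ [m]) ` (SIGMA m:{1..n}. strict_tuples (m - 1) r)"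
    by (force simp: strict_tuples_def sorted_wrt_append intro!: image_eqI[where x = "(m, ks)"])
next
  fix xs assume "xs \<in> (\<lambda>(m, ks). ks @ [m]) ` (SIGMA m:{1..n}. strict_tuples (m - 1) r)"
  then show "xs \<in> strict_tuples n (Suc r)"
    by (fastforce simp: strict_tuples_def sorted_wrt_append)
qed

lemma weak_tuples_Suc:
  "weak_tuples n (Suc r) = (\<lambda>(m, ks). ks @ [m]) ` (SIGMA m:{1..n}. weak_tuples m r)"
proof (intro equalityI subsetI)
  fix xs assume xs: "xs \<in> weak_tuples n (Suc r)"
  then obtain ks m where "xs = ks @ [m]"
    by (cases xs rule: rev_cases) (auto simp: weak_tuples_def)
  with xs show "xs \<in> (\<lambda>(m, ks). ks @ [m]) ` (SIGMA m:{1..n}. weak_tuples m r)"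
    by (force simp: weak_tuples_def sorted_wrt_append intro!: image_eqI[where x = "(m, ks)"])
next
  fix xs assume "xs \<in> (\<lambda>(m, ks). ks @ [m]) ` (SIGMA m:{1..n}. weak_tuples m r)"
  then show "xs \<in> weak_tuples n (Suc r)"
    by (fastforce simp: weak_tuples_def sorted_wrt_append)
qed

lemma prod_power_snoc:
  assumes "length ks = length s"
  shows "(\<Prod>l<length (s @ [t]). real ((ks @ [m]) ! l) ^ ((s @ [t]) ! l)) =
    (\<Prod>l<length s. real (ks ! l) ^ (s ! l)) * real m ^ t"
proof -
  have "(\<Prod>l<length s. real ((ks @ [m]) ! l) ^ ((s @ [t]) ! l)) =
      (\<Prod>l<length s. real (ks ! l) ^ (s ! l))"
    by (rule prod.cong) (auto simp: nth_append assms)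
  moreover have "(ks @ [m]) ! length s = m"
    using assms by (metis nth_append_length)
  ultimately show ?thesis by simp
qed

lemma mhs_H_snoc: "mhs_H n (s @ [t]) = (\<Sum>m=1..n. mhs_H (m - 1) s / real m ^ t)"
proof -
  let ?w = "\<lambda>s ks. 1 / (\<Prod>l<length s. real (ks ! l) ^ (s ! l))"
  let ?A = "SIGMA m:{1..n}. strict_tuples (m - 1) (length s)"
  have "mhs_H n (s @ [t]) = (\<Sum>(m, ks)\<in>?A. ?w (s @ [t]) (ks @ [m]))"
    unfolding mhs_H_def length_append_singleton strict_tuples_Suc
    by (subst sum.reindex) (auto simp: inj_on_def case_prod_unfold)
  also have "\<dots> = (\<Sum>(m, ks)\<in>?A. ?w s ks / real m ^ t)"
    by (intro sum.cong refl) (auto simp: strict_tuples_def prod_power_snoc[simplified])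
  also have "\<dots> = (\<Sum>m=1..n. \<Sum>ks\<in>strict_tuples (m - 1) (length s). ?w s ks / real m ^ t)"
    by (rule sum.Sigma[symmetric]) (simp_all add: finite_strict_tuples)
  finally show ?thesis by (simp add: mhs_H_def sum_divide_distrib)
qed

lemma mhs_S_snoc: "mhs_S n (s @ [t]) = (\<Sum>m=1..n. mhs_S m s / real m ^ t)"
proof -
  let ?w = "\<lambda>s ks. 1 / (\<Prod>l<length s. real (ks ! l) ^ (s ! l))"
  let ?A = "SIGMA m:{1..n}. weak_tuples m (length s)"
  have "mhs_S n (s @ [t]) = (\<Sum>(m, ks)\<in>?A. ?w (s @ [t]) (ks @ [m]))"
    unfolding mhs_S_def length_append_singleton weak_tuples_Suc
    by (subst sum.reindex) (auto simp: inj_on_def case_prod_unfold)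
  also have "\<dots> = (\<Sum>(m, ks)\<in>?A. ?w s ks / real m ^ t)"
    by (intro sum.cong refl) (auto simp: weak_tuples_def prod_power_snoc[simplified])
  also have "\<dots> = (\<Sum>m=1..n. \<Sum>ks\<in>weak_tuples m (length s). ?w s ks / real m ^ t)"
    by (rule sum.Sigma[symmetric]) (simp_all add: finite_weak_tuples)
  finally show ?thesis by (simp add: mhs_S_def sum_divide_distrib)
qed

section \<open>The alternating binomial transform\<close>

definition binomial_transform :: "(nat \<Rightarrow> real) \<Rightarrow> nat \<Rightarrow> real" where
  "binomial_transform g n = (\<Sum>k=1..n. (-1) ^ (k - 1) * real (n choose k) * g k)"

lemma binomial_transform_cong:
  assumes "\<And>k. 1 \<le> k \<Longrightarrow> k \<le> n \<Longrightarrow> f k = g k"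
  shows "binomial_transform f n = binomial_transform g n"
  unfolding binomial_transform_def by (intro sum.cong refl) (simp add: assms)

lemma binomial_absorb_divide:
  assumes "k \<ge> 1" "n \<ge> 1"
  shows "real (n choose k) / real n = real (n - 1 choose (k - 1)) / real k"
proof -
  have "k * (n choose k) = n * (n - 1 choose (k - 1))"
    using times_binomial_minus1_eq[of k n] assms by simp
  then have "real k * real (n choose k) = real n * real (n - 1 choose (k - 1))"
    by (metis of_nat_mult)
  then show ?thesis using assms by (simp add: field_simps)
qed

text \<open>The sum is the negative of the binomial expansion of \<open>(1 - 1) ^ n = 0\<close> without its zeroth term.\<close>

lemma binomial_transform_one:
  assumes "n \<ge> 1"
  shows "binomial_transform (\<lambda>_. 1) n = 1"
proof -
  have "0 = (\<Sum>k\<le>n. (-1) ^ k * real (n choose k))"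
    using choose_alternating_sum[of n, where ?'a = real] assms by simp
  also have "\<dots> = 1 + (\<Sum>k=1..n. (-1) ^ k * real (n choose k))"
    by (simp add: atMost_atLeast0 sum.atLeast_Suc_atMost)
  also have "(\<Sum>k=1..n. (-1) ^ k * real (n choose k)) = - binomial_transform (\<lambda>_. 1) n"
    unfolding binomial_transform_def sum_negf[symmetric]
  proof (intro sum.cong refl)
    fix k assume "k \<in> {1..n}"
    then show "(-1) ^ k * real (n choose k) = - ((-1) ^ (k - 1) * real (n choose k) * 1)"
      by (cases k) auto
  qed
  finally show ?thesis by simp
qed

text \<open>By Pascal's rule and absorption, the increment of the right-hand side from \<open>n - 1\<close> to \<open>n\<close>
  has coefficients \<open>(n - 1 choose (k - 1)) / k = (n choose k) / n\<close>.\<close>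

lemma sum_binomial_transform:
  "(\<Sum>m=1..n. binomial_transform g m / real m) = binomial_transform (\<lambda>k. g k / real k) n"
proof (induction n)
  case 0
  show ?case by (simp add: binomial_transform_def)
next
  case (Suc n)
  have "binomial_transform (\<lambda>k. g k / real k) n =
      (\<Sum>k=1..Suc n. (-1) ^ (k - 1) * real (n choose k) * (g k / real k))"
    by (simp add: binomial_transform_def)
  moreover have "binomial_transform g (Suc n) / real (Suc n) =
      (\<Sum>k=1..Suc n. (-1) ^ (k - 1) * real (n choose (k - 1)) * (g k / real k))"
    unfolding binomial_transform_def sum_divide_distrib
  proof (intro sum.cong refl)
    fix k assume k: "k \<in> {1..Suc n}"
    have "(-1) ^ (k - 1) * real (Suc n choose k) * g k / real (Suc n) =
        (-1) ^ (k - 1) * g k * (real (Suc n choose k) / real (Suc n))"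
      by simp
    also have "\<dots> = (-1) ^ (k - 1) * g k * (real (n choose (k - 1)) / real k)"
      using binomial_absorb_divide[of k "Suc n"] k by simp
    finally show "(-1) ^ (k - 1) * real (Suc n choose k) * g k / real (Suc n) =
        (-1) ^ (k - 1) * real (n choose (k - 1)) * (g k / real k)"
      by simp
  qed
  moreover have "binomial_transform (\<lambda>k. g k / real k) (Suc n) =
      (\<Sum>k=1..Suc n. (-1) ^ (k - 1) * real (n choose k) * (g k / real k)
        + (-1) ^ (k - 1) * real (n choose (k - 1)) * (g k / real k))"
    unfolding binomial_transform_def
  proof (intro sum.cong refl)
    fix k assume "k \<in> {1..Suc n}"
    then obtain l where "k = Suc l" by (cases k) auto
    then show "(-1) ^ (k - 1) * real (Suc n choose k) * (g k / real k) =
        (-1) ^ (k - 1) * real (n choose k) * (g k / real k)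
        + (-1) ^ (k - 1) * real (n choose (k - 1)) * (g k / real k)"
      by (simp add: algebra_simps add_divide_distrib)
  qed
  ultimately show ?case
    using Suc.IH by (simp add: sum.distrib)
qed

text \<open>Pascal's rule makes the terms telescope.\<close>

lemma alternating_binomial_tail:
  assumes "1 \<le> m" "m \<le> n"
  shows "(\<Sum>k=m..n. (-1) ^ (k - 1) * real (n choose k)) = (-1) ^ (m - 1) * real (n - 1 choose (m - 1))"
proof -
  define f where "f k = (-1) ^ k * real (n - 1 choose (k - 1))" for k
  have "(-1) ^ (k - 1) * real (n choose k) = f (Suc k) - f k" if "k \<in> {m..n}" for k
  proof -
    from that assms obtain k' n' where "k = Suc k'" "n = Suc n'"
      by (metis One_nat_def Suc_le_D atLeastAtMost_iff le_trans)
    then show ?thesis by (simp add: f_def algebra_simps)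
  qed
  then have "(\<Sum>k=m..n. (-1) ^ (k - 1) * real (n choose k)) = (\<Sum>k=m..n. f (Suc k) - f k)"
    by (intro sum.cong) auto
  also have "\<dots> = f (Suc n) - f m"
    using assms by (intro sum_Suc_diff) simp
  also have "\<dots> = (-1) ^ (m - 1) * real (n - 1 choose (m - 1))"
    using assms by (cases m) (simp_all add: f_def)
  finally show ?thesis .
qed

text \<open>In the transform of the partial sums, \<open>g m / m\<close> is weighted by an alternating binomial tail;
  its value \<open>\<plusminus>(n - 1 choose (m - 1))\<close> absorbs the \<open>m\<close> and leaves \<open>n\<close>.\<close>

lemma binomial_transform_divide:
  "binomial_transform g n / real n = binomial_transform (\<lambda>k. \<Sum>m=1..k. g m / real m) n"
proof (cases "n = 0")
  case True
  then show ?thesis by (simp add: binomial_transform_def)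
next
  case False
  have "binomial_transform (\<lambda>k. \<Sum>m=1..k. g m / real m) n =
      (\<Sum>k=1..n. \<Sum>m=1..k. (-1) ^ (k - 1) * real (n choose k) * (g m / real m))"
    by (simp add: binomial_transform_def sum_distrib_left)
  also have "\<dots> = (\<Sum>(k, m)\<in>(SIGMA k:{1..n}. {1..k}).
      (-1) ^ (k - 1) * real (n choose k) * (g m / real m))"
    by (rule sum.Sigma) auto
  also have "\<dots> = (\<Sum>(m, k)\<in>(SIGMA m:{1..n}. {m..n}).
      (-1) ^ (k - 1) * real (n choose k) * (g m / real m))"
    by (rule sum.reindex_bij_witness[of _ "\<lambda>(m, k). (k, m)" "\<lambda>(k, m). (m, k)"]) auto
  also have "\<dots> = (\<Sum>m=1..n. \<Sum>k=m..n. (-1) ^ (k - 1) * real (n choose k) * (g m / real m))"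
    by (rule sum.Sigma[symmetric]) auto
  also have "\<dots> = (\<Sum>m=1..n. (-1) ^ (m - 1) * real (n choose m) * g m / real n)"
  proof (intro sum.cong refl)
    fix m assume m: "m \<in> {1..n}"
    have "(\<Sum>k=m..n. (-1) ^ (k - 1) * real (n choose k) * (g m / real m)) =
        (-1) ^ (m - 1) * real (n - 1 choose (m - 1)) * (g m / real m)"
      using m by (simp only: sum_distrib_right[symmetric] alternating_binomial_tail atLeastAtMost_iff)
    also have "\<dots> = (-1) ^ (m - 1) * g m * (real (n - 1 choose (m - 1)) / real m)"
      by simp
    also have "\<dots> = (-1) ^ (m - 1) * g m * (real (n choose m) / real n)"
      using m False by (simp only: binomial_absorb_divide[symmetric] atLeastAtMost_iff)
    finally show "(\<Sum>k=m..n. (-1) ^ (k - 1) * real (n choose k) * (g m / real m)) =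
        (-1) ^ (m - 1) * real (n choose m) * g m / real n"
      by simp
  qed
  finally show ?thesis by (simp add: binomial_transform_def sum_divide_distrib)
qed

section \<open>The weak sum as a binomial transform\<close>

text \<open>The sequence \<open>(P D)\<^sup>p D\<^sup>a 1\<close>; for \<open>p \<ge> 1\<close> its value at \<open>k\<close> is \<open>S\<^sub>k(a + 1, {1}\<^sup>p\<^sup>-\<^sup>1)\<close>.\<close>

fun iterated_harmonic :: "nat \<Rightarrow> nat \<Rightarrow> nat \<Rightarrow> real" where
  "iterated_harmonic a 0 k = 1 / real k ^ a"
| "iterated_harmonic a (Suc p) k = (\<Sum>m=1..k. iterated_harmonic a p m / real m)"

lemma mhs_S_append_ones:
  assumes "\<And>m. m \<ge> 1 \<Longrightarrow> mhs_S m s = binomial_transform g m" "n \<ge> 1"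
  shows "mhs_S n (s @ replicate b 1) = binomial_transform (\<lambda>k. g k / real k ^ b) n"
  using assms(2)
proof (induction b arbitrary: n)
  case 0
  then show ?case by (simp add: assms(1))
next
  case (Suc b)
  have "mhs_S n (s @ replicate (Suc b) 1) = mhs_S n ((s @ replicate b 1) @ [1])"
    by (simp add: replicate_append_same)
  also have "\<dots> = (\<Sum>m=1..n. mhs_S m (s @ replicate b 1) / real m)"
    by (simp only: mhs_S_snoc power_one_right)
  also have "\<dots> = (\<Sum>m=1..n. binomial_transform (\<lambda>k. g k / real k ^ b) m / real m)"
    by (intro sum.cong refl) (simp only: Suc.IH atLeastAtMost_iff)
  also have "\<dots> = binomial_transform (\<lambda>k. g k / real k ^ Suc b) n"
    by (simp only: sum_binomial_transform divide_divide_eq_left power_Suc2)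
  finally show ?case .
qed

lemma binomial_transform_divide_power:
  "binomial_transform (iterated_harmonic a 0) n / real n ^ p =
    binomial_transform (iterated_harmonic a p) n"
proof (induction p)
  case 0
  show ?case by simp
next
  case (Suc p)
  have "binomial_transform (iterated_harmonic a 0) n / real n ^ Suc p =
      binomial_transform (iterated_harmonic a 0) n / real n ^ p / real n"
    by (simp add: mult.commute)
  then show ?case
    unfolding Suc.IH binomial_transform_divide
    by (simp cong: binomial_transform_cong)
qed

text \<open>Of the \<open>c = p + 1\<close> divisions in the distinguished slot, the last one is consumed by its partial
  sum; the other \<open>p\<close> commute past the transform one at a time and become \<open>(P D)\<^sup>p\<close>.\<close>

lemma mhs_S_hook:
  assumes "n \<ge> 1"
  shows "mhs_S n (replicate a 1 @ [Suc p] @ replicate b 1) =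
    binomial_transform (\<lambda>k. iterated_harmonic a p k / real k ^ Suc b) n"
proof -
  have ones: "mhs_S m (replicate a 1) = binomial_transform (iterated_harmonic a 0) m"
    if "m \<ge> 1" for m
    using mhs_S_append_ones[of "[]" "\<lambda>_. 1" m a] that
    by (simp add: mhs_S_Nil binomial_transform_one cong: binomial_transform_cong)
  have middle: "mhs_S m (replicate a 1 @ [Suc p]) =
      binomial_transform (\<lambda>k. iterated_harmonic a p k / real k) m" for m
  proof -
    have "mhs_S m (replicate a 1 @ [Suc p]) =
        (\<Sum>l=1..m. mhs_S l (replicate a 1) / real l ^ Suc p)"
      by (rule mhs_S_snoc)
    also have "\<dots> = (\<Sum>l=1..m. binomial_transform (iterated_harmonic a p) l / real l)"
    proof (intro sum.cong refl)
      fix l assume "l \<in> {1..m}"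
      then have "mhs_S l (replicate a 1) / real l ^ Suc p =
          binomial_transform (iterated_harmonic a 0) l / real l ^ p / real l"
        by (simp add: ones[simplified] mult.commute)
      then show "mhs_S l (replicate a 1) / real l ^ Suc p =
          binomial_transform (iterated_harmonic a p) l / real l"
        by (simp only: binomial_transform_divide_power)
    qed
    finally show ?thesis by (simp only: sum_binomial_transform)
  qed
  show ?thesis
    using mhs_S_append_ones[OF middle assms, of b] by (simp add: mult.commute)
qed

section \<open>From iterated weak sums to strict sums\<close>

text \<open>A splitting of \<open>p + 2\<close> either has \<open>j \<ge> 2\<close>, and then \<open>j\<close> can be lowered by one, or has
  \<open>j = 1\<close>. In the latter case the last entry of \<open>s\<close>, if there is one, takes the role of \<open>j\<close> in a
  splitting of \<open>p + 1\<close>; if there is none, \<open>i\<close> is forced.\<close>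

lemma splittings_Suc:
  "splittings (Suc (Suc p)) = (\<lambda>(i, j, s). (i, Suc j, s)) ` splittings (Suc p)
    \<union> (\<lambda>(i, j, s). (i, 1, s @ [j])) ` splittings (Suc p) \<union> {(Suc p, 1, [])}" (is "?L = ?R")
proof (intro equalityI subsetI)
  fix t assume t: "t \<in> ?L"
  obtain i j s where ijs: "t = (i, j, s)" by (cases t)
  note spl = t[unfolded ijs splittings_def, simplified]
  consider (lower) "j \<ge> 2" | (nil) "j = 1" "s = []" | (snoc) s' x where "j = 1" "s = s' @ [x]"
  proof (cases "j \<ge> 2")
    case False
    then have "j = 1" using spl by simp
    with nil snoc show thesis by (cases s rule: rev_cases) auto
  qed (rule lower)
  then show "t \<in> ?R"
  proof cases
    case lower
    then have "(i, j - 1, s) \<in> splittings (Suc p)" "t = (i, Suc (j - 1), s)"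
      using spl by (auto simp: ijs splittings_def)
    then show ?thesis by force
  next
    case nil
    then show ?thesis using spl by (simp add: ijs)
  next
    case snoc
    then have "(i, x, s') \<in> splittings (Suc p)"
      using spl by (auto simp: splittings_def)
    then show ?thesis using snoc by (force simp: ijs)
  qed
qed (auto simp: splittings_def)

lemma sum_splittings_Suc:
  fixes F :: "nat \<times> nat \<times> nat list \<Rightarrow> real"
  shows "(\<Sum>t\<in>splittings (Suc (Suc p)). F t) = (\<Sum>(i, j, s)\<in>splittings (Suc p). F (i, Suc j, s))
    + (\<Sum>(i, j, s)\<in>splittings (Suc p). F (i, 1, s @ [j])) + F (Suc p, 1, [])"
proof -
  let ?raise = "\<lambda>(i, j, s). (i, Suc j, s)" and ?snoc = "\<lambda>(i, j, s). (i, 1 :: nat, s @ [j])"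
  let ?A = "splittings (Suc p)"
  have "sum F (splittings (Suc (Suc p))) = sum F (?raise ` ?A \<union> ?snoc ` ?A) + sum F {(Suc p, 1, [])}"
    unfolding splittings_Suc
    by (rule sum.union_disjoint) (auto simp: finite_splittings, auto simp: splittings_def)
  moreover have "sum F (?raise ` ?A \<union> ?snoc ` ?A) = sum F (?raise ` ?A) + sum F (?snoc ` ?A)"
    by (rule sum.union_disjoint) (auto simp: finite_splittings, auto simp: splittings_def)
  moreover have "sum F (?raise ` ?A) = (\<Sum>(i, j, s)\<in>?A. F (i, Suc j, s))"
    by (subst sum.reindex) (auto simp: inj_on_def case_prod_unfold)
  moreover have "sum F (?snoc ` ?A) = (\<Sum>(i, j, s)\<in>?A. F (i, 1, s @ [j]))"
    by (subst sum.reindex) (auto simp: inj_on_def case_prod_unfold)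
  ultimately show ?thesis by simp
qed

text \<open>In the step, the outermost index \<open>m \<le> k\<close> is either \<open>k\<close>, which raises \<open>j\<close>, or it is smaller,
  and then it becomes the last index of a strict sum bounded by \<open>k - 1\<close>, with the accumulated
  multiplicity \<open>j\<close> as its exponent. The leading term accounts for all indices being equal to \<open>k\<close>.\<close>

lemma iterated_harmonic_eq_mhs_H:
  assumes "k \<ge> 1"
  shows "iterated_harmonic a p k = 1 / real k ^ (a + p)
    + (\<Sum>(i, j, s)\<in>splittings (Suc p). mhs_H (k - 1) ((a + i) # s) / real k ^ (j - 1))"
  using assms
proof (induction p arbitrary: k)
  case 0
  have "splittings (Suc 0) = {}" by (auto simp: splittings_def)
  then show ?case by simp
next
  case (Suc p)
  have IH: "iterated_harmonic a p m / real m = 1 / real m ^ (a + Suc p)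
      + (\<Sum>(i, j, s)\<in>splittings (Suc p). mhs_H (m - 1) ((a + i) # s) / real m ^ j)"
    if "m \<ge> 1" for m
  proof -
    have "(\<Sum>(i, j, s)\<in>splittings (Suc p). mhs_H (m - 1) ((a + i) # s) / real m ^ (j - 1)) / real m
        = (\<Sum>(i, j, s)\<in>splittings (Suc p). mhs_H (m - 1) ((a + i) # s) / real m ^ j)"
      unfolding sum_divide_distrib
    proof (intro sum.cong refl, clarify)
      fix i j s assume "(i, j, s) \<in> splittings (Suc p)"
      then obtain j' where "j = Suc j'" by (cases j) (auto simp: splittings_def)
      then show "mhs_H (m - 1) ((a + i) # s) / real m ^ (j - 1) / real m =
          mhs_H (m - 1) ((a + i) # s) / real m ^ j"
        by (simp add: mult.commute)
    qed
    then show ?thesis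
      by (simp add: Suc.IH[OF that] add_divide_distrib mult.commute)
  qed
  have below: "(\<Sum>m=1..k - 1. iterated_harmonic a p m / real m) = mhs_H (k - 1) [a + Suc p]
      + (\<Sum>(i, j, s)\<in>splittings (Suc p). mhs_H (k - 1) ((a + i) # s @ [j]))"
  proof -
    have "(\<Sum>m=1..k - 1. iterated_harmonic a p m / real m) =
        (\<Sum>m=1..k - 1. 1 / real m ^ (a + Suc p)
          + (\<Sum>(i, j, s)\<in>splittings (Suc p). mhs_H (m - 1) ((a + i) # s) / real m ^ j))"
      by (intro sum.cong refl IH) simp
    also have "\<dots> = (\<Sum>m=1..k - 1. 1 / real m ^ (a + Suc p))
        + (\<Sum>(i, j, s)\<in>splittings (Suc p).
            \<Sum>m=1..k - 1. mhs_H (m - 1) ((a + i) # s) / real m ^ j)"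
      unfolding sum.distrib case_prod_unfold by (subst (2) sum.swap) (rule refl)
    also have "(\<Sum>m=1..k - 1. 1 / real m ^ (a + Suc p)) = mhs_H (k - 1) [a + Suc p]"
      using mhs_H_snoc[of "k - 1" "[]" "a + Suc p"] by (simp add: mhs_H_Nil)
    finally show ?thesis
      by (simp only: mhs_H_snoc append_Cons[symmetric])
  qed
  have "{1..k} = insert k {1..k - 1}" using Suc.prems by auto
  then have "iterated_harmonic a (Suc p) k = iterated_harmonic a p k / real k
      + (\<Sum>m=1..k - 1. iterated_harmonic a p m / real m)"
    using Suc.prems by simp
  then show ?case
    unfolding IH[OF Suc.prems] below sum_splittings_Suc by (simp add: case_prod_unfold)
qed

section \<open>The binomial formula for weak sums\<close>

theorem theorem2p2:
  fixes n a b c :: nat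
  assumes "n \<ge> 1" and "c \<ge> 1"
  shows "mhs_S n (replicate a 1 @ [c] @ replicate b 1) =
      (\<Sum>k=1..n. (-1) ^ (k - 1) * real (n choose k) / real k ^ (a + b + c))
    + (\<Sum>(i, j, s)\<in>splittings c. \<Sum>k=1..n.
         mhs_H (k - 1) ((a + i) # s) * (-1) ^ (k - 1) * real (n choose k) / real k ^ (b + j))"
proof -
  obtain p where c: "c = Suc p" using assms(2) by (cases c) auto
  have summand: "(-1) ^ (k - 1) * real (n choose k) * (iterated_harmonic a p k / real k ^ Suc b) =
      (-1) ^ (k - 1) * real (n choose k) / real k ^ (a + b + c)
      + (\<Sum>(i, j, s)\<in>splittings c.
          mhs_H (k - 1) ((a + i) # s) * (-1) ^ (k - 1) * real (n choose k) / real k ^ (b + j))"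
    (is "?w * _ = _ + ?H") if k: "k \<in> {1..n}" for k
  proof -
    have "?w * ((\<Sum>(i, j, s)\<in>splittings c. mhs_H (k - 1) ((a + i) # s) / real k ^ (j - 1))
        / real k ^ Suc b) = ?H"
      unfolding sum_divide_distrib sum_distrib_left
    proof (intro sum.cong refl, clarify)
      fix i j s assume "(i, j, s) \<in> splittings c"
      then obtain j' where "j = Suc j'" by (cases j) (auto simp: splittings_def)
      then show "?w * (mhs_H (k - 1) ((a + i) # s) / real k ^ (j - 1) / real k ^ Suc b) =
          mhs_H (k - 1) ((a + i) # s) * (-1) ^ (k - 1) * real (n choose k) / real k ^ (b + j)"
        by (simp add: power_add mult_ac)
    qed
    moreover have "?w * (1 / real k ^ (a + p) / real k ^ Suc b) = ?w / real k ^ (a + b + c)"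
      by (simp add: c power_add mult_ac)
    moreover have "iterated_harmonic a p k = 1 / real k ^ (a + p)
        + (\<Sum>(i, j, s)\<in>splittings c. mhs_H (k - 1) ((a + i) # s) / real k ^ (j - 1))"
      using iterated_harmonic_eq_mhs_H[of k a p] k by (simp add: c)
    ultimately show ?thesis
      by (simp only: add_divide_distrib distrib_left)
  qed
  have "mhs_S n (replicate a 1 @ [c] @ replicate b 1) =
      (\<Sum>k=1..n. (-1) ^ (k - 1) * real (n choose k) * (iterated_harmonic a p k / real k ^ Suc b))"
    unfolding c mhs_S_hook[OF assms(1)] binomial_transform_def ..
  also have "\<dots> = (\<Sum>k=1..n. (-1) ^ (k - 1) * real (n choose k) / real k ^ (a + b + c)
      + (\<Sum>(i, j, s)\<in>splittings c.
          mhs_H (k - 1) ((a + i) # s) * (-1) ^ (k - 1) * real (n choose k) / real k ^ (b + j)))"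
    by (intro sum.cong refl summand)
  also have "\<dots> = (\<Sum>k=1..n. (-1) ^ (k - 1) * real (n choose k) / real k ^ (a + b + c))
    + (\<Sum>(i, j, s)\<in>splittings c. \<Sum>k=1..n.
         mhs_H (k - 1) ((a + i) # s) * (-1) ^ (k - 1) * real (n choose k) / real k ^ (b + j))"
    unfolding sum.distrib case_prod_unfold by (subst (2) sum.swap) (rule refl)
  finally show ?thesis .
qed

end
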